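(* For every $n\ge1$, if $(A,\lambda)$ is drawn from the standard distribution $\rho_{\mathrm{std}}$ on $V=\{(A,\lambda)\in\mathbb{C}^{n\times n}\times\mathbb{C}\mid \det(A-\lambda\,\mathrm{Id})=0\}$, then $$\mathbb{E}_{(A,\lambda)\sim\rho_{\mathrm{std}}}\big(\mathrm{cond}^2(\chi_A,\lambda)\big)\ \ge\ (n-1)!\,2^n .$$
   Context: A random matrix $A\in\mathbb{C}^{n\times n}$ is standard Gaussian if the real and imaginary parts of all its entries are independent standard (mean $0$, variance $1$) real Gaussian random variables. The standard distribution $\rho_{\mathrm{std}}$ on $V$ is obtained by drawing $A$ standard Gaussian and then drawing $\lambda$ uniformly at random from the (almost surely) $n$ different eigenvalues of $A$; thus the expectation above equals $\mathbb{E}_A\big(\frac1n\sum_{i=1}^n\mathrm{cond}^2(\chi_A,\lambda_i)\big)$, where $\lambda_1,\ldots,\lambda_n$ are the eigenvalues of $A$. The expectation of a nonnegative random variable is taken in $[0,+\infty]$. The characteristic polynomial is $\chi_A(X)=(X-\lambda_1)\cdots(X-\lambda_n)$. Condition number: for a polynomial $f(X)=a_nX^n+\cdots+a_1X+a_0\in\mathbb{C}[X]$ of degree $n$ put $\|f\|^2=\sum_{k=0}^n|a_k|^2$. The (relative normwise) condition number of $f$ at a zero $\zeta\in\mathbb{C}$ is $$\mathrm{cond}(f,\zeta):=\lim_{\delta\to0}\ \sup_{\|\tilde f-f\|\le\delta}\frac{|\tilde\zeta-\zeta|}{\|\tilde f-f\|}\,\frac{\|f\|}{|\zeta|},$$ where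 $\tilde f$ ranges over polynomials of degree at most $n$ and $\tilde\zeta$ is the zero of $\tilde f$ corresponding to $\zeta$. For a simple zero $\zeta\ne0$ it takes the form $$\mathrm{cond}(f,\zeta)=\frac{\|f\|}{|\zeta|}\,\frac{1}{|f'(\zeta)|}\,\big\|(1,|\zeta|,\ldots,|\zeta|^n)\big\|,$$ where the last norm is the Euclidean norm on $\mathbb{R}^{n+1}$; if $\zeta$ is a multiple zero or $\zeta=0$ the value is $+\infty$. Here $\mathrm{cond}^2(\chi_A,\lambda)$ means $(\mathrm{cond}(\chi_A,\lambda))^2$. *)

theory Defs
  imports "HOL-Probability.Probability" "HOL-Computational_Algebra.Polynomial"
begin

definition charpoly :: "complex^'n^'n \<Rightarrow> complex poly" where
  "charpoly A = det (mat [:0, 1:] - (\<chi> i j. [:A $ i $ j:]))"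

definition poly_norm :: "complex poly \<Rightarrow> real" where
  "poly_norm p = sqrt (\<Sum>k\<le>degree p. (cmod (coeff p k))\<^sup>2)"

text \<open>
  The zero of \<open>g\<close> corresponding to the zero \<open>z\<close> of \<open>f\<close> is the one reached by following \<open>z\<close>
  continuously while \<open>f\<close> is deformed into \<open>g\<close> along the line segment between them.  If \<open>z\<close> is
  a simple zero of \<open>f\<close>, there is exactly one such zero for every \<open>g\<close> of degree at most
  \<open>degree f\<close> that is sufficiently close to \<open>f\<close>.
\<close>

definition corresponding_zero ::
    "complex poly \<Rightarrow> complex \<Rightarrow> complex poly \<Rightarrow> complex \<Rightarrow> bool" where
  "corresponding_zero f z g w \<longleftrightarrow>
     (\<exists>\<gamma>. path \<gamma> \<and> pathstart \<gamma> = z \<and> pathfinish \<gamma> = w \<and>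
          (\<forall>t\<in>{0..1}. poly (f + smult (complex_of_real t) (g - f)) (\<gamma> t) = 0))"

text \<open>
  Relative normwise condition number of \<open>f\<close> at a zero \<open>z\<close>.  The supremum decreases
  as \<open>\<delta>\<close> decreases to 0, so the limit always exists.
\<close>

definition cond :: "complex poly \<Rightarrow> complex \<Rightarrow> ennreal" where
  "cond f z =
     (if z = 0 \<or> order z f > 1 then \<infinity>
      else Lim (at_right (0::real))
        (\<lambda>\<delta>. SUP (g, w) \<in> {(g, w). degree g \<le> degree f \<and> g \<noteq> f \<and>
                                   poly_norm (g - f) \<le> \<delta> \<and> corresponding_zero f z g w}.
              ennreal (cmod (w - z) / poly_norm (g - f) * (poly_norm f / cmod z))))"

text \<open>
  The coordinates indexed by \<open>(i, j, False)\<close> and \<open>(i, j, True)\<close> are the real and the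
  imaginary part of the \<open>(i, j)\<close> entry.
\<close>

definition std_gaussian_matrix :: "(complex^'n^'n) measure" where
  "std_gaussian_matrix =
     distr (\<Pi>\<^sub>M k\<in>(UNIV :: ('n \<times> 'n \<times> bool) set). density lborel std_normal_density) borel
       (\<lambda>x. \<chi> i j. Complex (x (i, j, False)) (x (i, j, True)))"

definition eigenpairs :: "((complex^'n^'n) \<times> complex) set" where
  "eigenpairs = {(A, l). det (A - mat l) = 0}"

text \<open>
  Every matrix has at least one and only finitely many eigenvalues, as \<open>pmf_of_set\<close> requires,
  and \<open>rho_std\<close> is a probability measure with space \<open>eigenpairs\<close>.
\<close>

definition rho_std :: "((complex^'n^'n) \<times> complex) measure" where
  "rho_std =
     restrict_space
       (std_gaussian_matrix \<bind>
          (\<lambda>A. distr (measure_pmf (pmf_of_set {l. (A, l) \<in> eigenpairs})) borel (\<lambda>l. (A, l))))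
       eigenpairs"

end

theory Submission
  imports Defs "HOL-Complex_Analysis.Conformal_Mappings"
    "HOL-Computational_Algebra.Fundamental_Theorem_Algebra"
begin

text \<open>
  The expectation is \<open>+\<infinity>\<close>, so it exceeds every bound.  Let \<open>f\<close> be the characteristic polynomial
  of \<open>A\<close>, of degree \<open>n\<close>.  Perturbing the constant coefficient of \<open>f\<close> by \<open>s\<close> moves a simple zero
  \<open>z\<close> by about \<open>|s| / |f'(z)|\<close>, and \<open>f\<close> is monic, hence has norm at least 1; so
  \<open>cond f z \<ge> 1 / (|z| |f'(z)|)\<close> (\<open>cond_ge\<close>).  If all zeros of \<open>f\<close> are simple and nonzero,
  the partial fraction decomposition of \<open>1 / f\<close> at the origin reads
  \<open>-1 / f(0) = \<Sum>z. 1 / (z f'(z))\<close>, and the Cauchy--Schwarz inequality shows that the mean of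
  \<open>cond f z ^ 2\<close> over the zeros is at least \<open>1 / (n |f(0)|)^2 = 1 / (n |det A|)^2\<close>
  (\<open>mean_inverse_square_roots_ge\<close>); in the degenerate cases that mean is infinite anyway.

  It remains to see that \<open>1 / |det A|^2\<close> has infinite expectation
  (\<open>expectation_inverse_square_det_infinite\<close>).  As a function of a single diagonal entry \<open>w\<close>
  the determinant is affine, \<open>M w + r\<close>.  Whenever the cofactor \<open>M\<close> is nonzero, integrating over
  \<open>w\<close> means, up to the factor \<open>1 / |M|^2\<close>, integrating \<open>1 / |w - w0|^2\<close> for \<open>w0 = -r / M\<close> against a positive continuous
  density in the plane, which diverges logarithmically at \<open>w0\<close>.  And \<open>M\<close> is nonzero with
  positive probability, because it is nonzero near the identity matrix.

  To integrate against \<open>rho_std\<close> at all, the map sending \<open>A\<close> to the uniform distribution on its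
  eigenvalues has to be a measurable kernel.  This comes down to the measurability of the number of
  distinct eigenvalues \<open>l\<close> with \<open>(A, l)\<close> in a given closed set
  (\<open>borel_measurable_card_sections\<close>).
\<close>

section \<open>Characteristic polynomials\<close>

lemma poly_charpoly: "poly (charpoly A) x = det (mat x - A)"
  unfolding charpoly_def det_def
  by (simp add: poly_sum poly_prod mat_def if_distrib[of "\<lambda>p. poly p x"] cong: if_cong)

text \<open>
  In the Leibniz expansion only the identity permutation contributes a term of full degree: any
  other permutation picks at least one off-diagonal, hence constant, entry.
\<close>

lemma degree_monic_charpoly:
  fixes A :: "complex^'n^'n"
  shows "degree (charpoly A) = CARD('n)" and "lead_coeff (charpoly A) = 1"
proof -
  define B where "B = mat [:0, 1:] - (\<chi> i j. [:A $ i $ j:])"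
  define D where "D = (\<Prod>i\<in>UNIV. B $ i $ i)"
  have Bii: "B $ i $ i = [:- (A $ i $ i), 1:]" for i
    by (simp add: B_def mat_def)
  have degB: "degree (B $ i $ j) \<le> (if i = j then 1 else 0)" for i j
    by (simp add: B_def mat_def)
  have degD: "degree D = CARD('n)"
    unfolding D_def by (subst degree_prod_eq_sum_degree) (auto simp: Bii)
  have lcD: "lead_coeff D = 1"
    unfolding D_def lead_coeff_prod by (simp add: Bii)
  define R where
    "R = (\<Sum>p\<in>{p. p permutes UNIV} - {id}. of_int (sign p) * (\<Prod>i\<in>UNIV. B $ i $ p i))"
  have "charpoly A = D + R"
    unfolding charpoly_def B_def[symmetric] det_def R_def D_def
    by (subst sum.remove[of _ id]) (auto simp: permutes_id sign_id)
  have degR: "degree R < CARD('n)"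
    unfolding R_def
  proof (rule degree_sum_less)
    fix p :: "'n \<Rightarrow> 'n" assume "p \<in> {p. p permutes UNIV} - {id}"
    then obtain k where k: "p k \<noteq> k" by (auto simp: fun_eq_iff)
    have "degree (of_int (sign p) * (\<Prod>i\<in>UNIV. B $ i $ p i)) \<le> degree (\<Prod>i\<in>UNIV. B $ i $ p i)"
      by (cases p rule: sign_cases) auto
    also have "\<dots> \<le> (\<Sum>i\<in>UNIV. degree (B $ i $ p i))"
      using degree_prod_sum_le[of UNIV "\<lambda>i. B $ i $ p i"] by (simp add: o_def)
    also have "\<dots> \<le> (\<Sum>i\<in>UNIV. if i = p i then 1 else 0)"
      by (intro sum_mono degB)
    also have "\<dots> = card {i. i = p i}" by (simp add: sum.If_cases)
    also have "\<dots> < CARD('n)"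
      using k by (intro psubset_card_mono) (auto simp: set_eq_iff)
    finally show "degree (of_int (sign p) * (\<Prod>i\<in>UNIV. B $ i $ p i)) < CARD('n)" .
  qed auto
  show "degree (charpoly A) = CARD('n)"
    using degD degR degree_add_eq_left[of R D] \<open>charpoly A = D + R\<close> by simp
  then show "lead_coeff (charpoly A) = 1"
    using lcD degR degD \<open>charpoly A = D + R\<close> by (simp add: coeff_eq_0)
qed

lemma det_uminus: "det (- M) = (- 1) ^ CARD('n) * det (M :: 'a::comm_ring_1^'n^'n)"
proof -
  have "(\<Prod>i\<in>UNIV. - (M $ i $ p i)) = (- 1) ^ CARD('n) * (\<Prod>i\<in>UNIV. M $ i $ p i)" for p
    using prod.distrib[of "\<lambda>i. - 1" "\<lambda>i. M $ i $ p i" UNIV] by simp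
  then show ?thesis
    by (simp add: det_def sum_distrib_left mult_ac)
qed

lemma eigenvalues_eq_roots: "{l. (A, l) \<in> eigenpairs} = {l. poly (charpoly A) l = 0}"
proof -
  have "det (A - mat l) = 0 \<longleftrightarrow> det (mat l - A) = 0" for l
    using det_uminus[of "mat l - A"] by simp
  then show ?thesis by (simp add: eigenpairs_def poly_charpoly)
qed

section \<open>A lower bound for the condition number\<close>

text \<open>
  The limit in the definition of \<open>cond\<close> is taken with \<open>Lim\<close>; monotonicity in \<open>\<delta>\<close> makes it an
  infimum, so that it can be bounded below for each \<open>\<delta>\<close> separately.
\<close>

lemma mono_tendsto_INF_at_right:
  fixes S :: "real \<Rightarrow> ennreal"
  assumes "\<And>x y. 0 < x \<Longrightarrow> x \<le> y \<Longrightarrow> S x \<le> S y"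
  shows "(S \<longlongrightarrow> (INF \<delta>\<in>{0<..}. S \<delta>)) (at_right 0)"
proof (rule order_tendstoI)
  fix a assume "a < (INF \<delta>\<in>{0<..}. S \<delta>)"
  then show "\<forall>\<^sub>F x in at_right 0. a < S x"
    unfolding eventually_at_right_field
    by (intro exI[of _ 1]) (auto intro: less_le_trans INF_lower)
next
  fix a assume "(INF \<delta>\<in>{0<..}. S \<delta>) < a"
  then obtain d where "0 < d" "S d < a" by (auto simp: INF_less_iff)
  then show "\<forall>\<^sub>F x in at_right 0. S x < a"
    unfolding eventually_at_right_field
    by (intro exI[of _ d]) (auto intro: le_less_trans[OF assms[of _ d]])
qed

text \<open>
  The branch \<open>h\<close> follows the zero \<open>z\<close> of \<open>f\<close> to the zero of \<open>f - y\<close>; it is the local inverse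
  of \<open>f\<close> at \<open>z\<close>.
\<close>

lemma local_root_branch:
  fixes f :: "complex poly"
  assumes "poly f z = 0" and "poly (pderiv f) z \<noteq> 0"
  obtains h \<rho> where "0 < \<rho>" "h holomorphic_on ball 0 \<rho>" "h 0 = z"
    "\<And>y. y \<in> ball 0 \<rho> \<Longrightarrow> poly f (h y) = y"
    "(h has_field_derivative inverse (poly (pderiv f) z)) (at 0)"
proof -
  have d: "deriv (poly f) z = poly (pderiv f) z"
    by (rule DERIV_imp_deriv) (rule poly_DERIV)
  have hol: "poly f holomorphic_on S" for S
    by (intro holomorphic_intros)
  have "deriv (poly f) z \<noteq> 0" using assms(2) d by simp
  from has_complex_derivative_locally_invertible[OF hol UNIV_I open_UNIV this]
  obtain r where r: "r > 0" "open (poly f ` ball z r)" "inj_on (poly f) (ball z r)"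
    by metis
  obtain h where h: "h holomorphic_on (poly f ` ball z r)"
      "\<And>x. x \<in> ball z r \<Longrightarrow> deriv (poly f) x * deriv h (poly f x) = 1"
      "\<And>x. x \<in> ball z r \<Longrightarrow> h (poly f x) = x"
    using holomorphic_has_inverse[OF hol open_ball r(3)] by metis
  have z: "z \<in> ball z r" using r by simp
  then have "0 \<in> poly f ` ball z r" using assms by force
  then obtain \<rho> where \<rho>: "0 < \<rho>" "ball 0 \<rho> \<subseteq> poly f ` ball z r"
    using r(2) open_contains_ball by blast
  have holh: "h holomorphic_on ball 0 \<rho>" using h(1) \<rho>(2) holomorphic_on_subset by blast
  have "h field_differentiable at 0"
    using holh \<rho>(1) holomorphic_on_imp_differentiable_at by auto
  then have "(h has_field_derivative deriv h 0) (at 0)"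
    using field_differentiable_derivI by blast
  moreover have "deriv h 0 = inverse (poly (pderiv f) z)"
    using h(2)[OF z] assms d by (simp add: inverse_unique)
  moreover have "poly f (h y) = y" if "y \<in> ball 0 \<rho>" for y
    using that \<rho>(2) h(3) by (metis (no_types, lifting) image_iff subset_iff)
  ultimately show ?thesis using that[OF \<rho>(1) holh] h(3)[OF z] assms(1) by auto
qed

lemma poly_norm_const [simp]: "poly_norm [:s:] = cmod s"
  by (simp add: poly_norm_def)

text \<open>
  Perturbations of the constant coefficient alone already give this bound: replacing \<open>f\<close> by
  \<open>f - s\<close> moves \<open>z\<close> along the branch of the previous lemma, and the quotient \<open>|h s - h 0| / |s|\<close>
  tends to \<open>1 / |f'(z)|\<close>.  At \<open>z = 0\<close> and at multiple zeros the left-hand side is infinite, in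
  accordance with \<open>cond\<close>.
\<close>

lemma cond_ge:
  assumes root: "poly f z = 0" and deg: "0 < degree f"
  shows "ennreal (poly_norm f) * inverse (ennreal (cmod z * cmod (poly (pderiv f) z))) \<le> cond f z"
proof (cases "z = 0 \<or> order z f > 1")
  case True
  then show ?thesis by (simp add: cond_def)
next
  case False
  then have z: "z \<noteq> 0" and ord: "order z f \<le> 1" by auto
  have f0: "f \<noteq> 0" using deg by auto
  have "pderiv f \<noteq> 0" using deg by (simp add: pderiv_eq_0_iff)
  then have simple: "poly (pderiv f) z \<noteq> 0"
    using ord order_pderiv[OF f0 root] order_root[of "pderiv f" z] by auto
  obtain h \<rho> where h: "0 < \<rho>" "h holomorphic_on ball 0 \<rho>" "h 0 = z"
    "\<And>y. y \<in> ball 0 \<rho> \<Longrightarrow> poly f (h y) = y"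
    "(h has_field_derivative inverse (poly (pderiv f) z)) (at 0)"
    using local_root_branch[OF root simple] by metis
  define G where "G = (\<lambda>\<delta>. {(g, w). degree g \<le> degree f \<and> g \<noteq> f \<and>
                                   poly_norm (g - f) \<le> \<delta> \<and> corresponding_zero f z g w})"
  define F where "F = (\<lambda>(g, w). ennreal (cmod (w - z) / poly_norm (g - f) * (poly_norm f / cmod z)))"
  define S where "S = (\<lambda>\<delta>. SUP x\<in>G \<delta>. F x)"
  have cond: "cond f z = Lim (at_right 0) S"
    using False by (simp add: cond_def S_def G_def F_def case_prod_unfold)
  have mono: "S x \<le> S y" if "x \<le> y" for x y
    unfolding S_def using that by (intro SUP_subset_mono) (auto simp: G_def)
  have "(S \<longlongrightarrow> (INF \<delta>\<in>{0<..}. S \<delta>)) (at_right 0)"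
    by (rule mono_tendsto_INF_at_right) (rule mono)
  then have cond': "cond f z = (INF \<delta>\<in>{0<..}. S \<delta>)"
    unfolding cond by (intro tendsto_Lim) auto
  have "ennreal (cmod (inverse (poly (pderiv f) z)) * (poly_norm f / cmod z)) \<le> S \<delta>"
    if \<delta>: "0 < \<delta>" for \<delta>
  proof (rule tendsto_upperbound)
    have "((\<lambda>s. (h s - h 0) / s) \<longlongrightarrow> inverse (poly (pderiv f) z)) (at 0)"
      using h(5) by (simp add: has_field_derivative_iff)
    then show "((\<lambda>s. ennreal (cmod ((h s - h 0) / s) * (poly_norm f / cmod z))) \<longlongrightarrow>
        ennreal (cmod (inverse (poly (pderiv f) z)) * (poly_norm f / cmod z))) (at 0)"
      by (intro tendsto_intros tendsto_ennrealI)
    show "\<forall>\<^sub>F s in at 0. ennreal (cmod ((h s - h 0) / s) * (poly_norm f / cmod z)) \<le> S \<delta>"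
      unfolding eventually_at
    proof (intro exI[of _ "min \<rho> \<delta>"] conjI ballI impI)
      fix s :: complex assume "s \<noteq> 0 \<and> dist s 0 < min \<rho> \<delta>"
      then have s: "s \<noteq> 0" "cmod s < \<rho>" "cmod s < \<delta>" by auto
      have in_ball: "complex_of_real t * s \<in> ball 0 \<rho>" if "t \<in> {0..1}" for t
      proof -
        have "cmod (complex_of_real t * s) \<le> 1 * cmod s"
          unfolding norm_mult using that by (intro mult_right_mono) auto
        then show ?thesis using s by simp
      qed
      define \<gamma> where "\<gamma> = (\<lambda>t. h (complex_of_real t * s))"
      have "path \<gamma>"
        unfolding path_def \<gamma>_def
        by (rule continuous_on_compose2[OF holomorphic_on_imp_continuous_on[OF h(2)]])
           (use in_ball in \<open>auto intro!: continuous_intros\<close>)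
      moreover have "poly (f + smult (complex_of_real t) ((f + [:- s:]) - f)) (\<gamma> t) = 0"
        if "t \<in> {0..1}" for t
        using h(4)[OF in_ball[OF that]] by (simp add: \<gamma>_def)
      ultimately have "corresponding_zero f z (f + [:- s:]) (h s)"
        unfolding corresponding_zero_def
        by (intro exI[of _ \<gamma>]) (auto simp: \<gamma>_def pathstart_def pathfinish_def h(3))
      moreover have "degree (f + [:- s:]) \<le> degree f"
        by (rule degree_add_le) auto
      ultimately have "(f + [:- s:], h s) \<in> G \<delta>"
        using s by (auto simp: G_def)
      then have "F (f + [:- s:], h s) \<le> S \<delta>"
        unfolding S_def by (rule SUP_upper)
      then show "ennreal (cmod ((h s - h 0) / s) * (poly_norm f / cmod z)) \<le> S \<delta>"
        by (simp add: F_def h(3) norm_divide)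
    qed (use h(1) \<delta> in auto)
  qed auto
  then have "ennreal (cmod (inverse (poly (pderiv f) z)) * (poly_norm f / cmod z)) \<le> cond f z"
    unfolding cond' by (intro INF_greatest) auto
  moreover have "0 \<le> poly_norm f" by (simp add: poly_norm_def sum_nonneg)
  ultimately show ?thesis
    using z simple
    by (simp add: inverse_ennreal ennreal_mult[symmetric] norm_inverse mult_ac
        inverse_eq_divide norm_divide)
qed

lemma poly_norm_monic: "lead_coeff f = 1 \<Longrightarrow> 1 \<le> poly_norm f"
  unfolding poly_norm_def
  using member_le_sum[of "degree f" "{..degree f}" "\<lambda>k. (cmod (coeff f k))\<^sup>2"] by simp

section \<open>Partial fractions at the origin\<close>

text \<open>
  This is \<open>1 / f(x) = \<Sum>z. 1 / (f'(z) (x - z))\<close> at \<open>x = 0\<close>.  The identity is Lagrange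
  interpolation of the constant polynomial 1 at the zeros of \<open>f\<close>.
\<close>

lemma partial_fraction_at_0:
  fixes f :: "complex poly"
  assumes "lead_coeff f = 1" "0 < degree f" "rsquarefree f" "poly f 0 \<noteq> 0"
  shows "(\<Sum>z | poly f z = 0. 1 / (z * poly (pderiv f) z)) = - 1 / poly f 0"
proof -
  define R where "R = {z. poly f z = 0}"
  have f0: "f \<noteq> 0" using assms by auto
  then have fin: "finite R" by (simp add: R_def poly_roots_finite)
  have f: "f = (\<Prod>z\<in>R. [:-z, 1:])"
    using complex_poly_decompose_rsquarefree[OF assms(3)] assms(1) by (simp add: R_def)
  have card: "card R = degree f"
    by (subst f, subst degree_prod_eq_sum_degree) auto
  define Q where "Q z = (\<Prod>y\<in>R - {z}. [:-y, 1:])" for z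
  have fQ: "f = [:-z, 1:] * Q z" if "z \<in> R" for z
    unfolding Q_def by (subst f, subst prod.remove[OF fin that]) simp
  have deriv: "poly (pderiv f) z = poly (Q z) z" if "z \<in> R" for z
    by (subst fQ[OF that], subst pderiv_mult) (simp add: pderiv_pCons)
  have Qneq: "poly (Q z) y = 0" if "y \<in> R" "z \<in> R" "y \<noteq> z" for y z
    using that fin by (auto simp: Q_def poly_prod)
  have Qeq: "poly (Q z) z \<noteq> 0" if "z \<in> R" for z
    using fin by (auto simp: Q_def poly_prod)
  \<comment> \<open>The Lagrange interpolant of 1, since \<open>f'(z) = Q z z\<close>.\<close>
  define L where "L = (\<Sum>z\<in>R. smult (1 / poly (pderiv f) z) (Q z))"
  have "L = 1"
  proof (rule poly_eqI_degree)
    fix y assume y: "y \<in> R"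
    have "poly L y = (\<Sum>z\<in>R. if z = y then 1 else 0)"
      unfolding L_def poly_sum
      using y by (intro sum.cong) (auto simp: Qneq deriv Qeq)
    then show "poly L y = poly 1 y" using y fin by simp
  next
    have "degree (smult (1 / poly (pderiv f) z) (Q z)) < card R" if "z \<in> R" for z
    proof -
      have "degree (Q z) = card (R - {z})"
        unfolding Q_def by (subst degree_prod_eq_sum_degree) auto
      also have "\<dots> < card R" using fin that by (intro psubset_card_mono) auto
      finally show ?thesis using degree_smult_le le_less_trans by blast
    qed
    then show "card R > degree L"
      unfolding L_def using assms(2) card by (intro degree_sum_less) auto
    show "card R > degree (1 :: complex poly)" using assms(2) card by simp
  qed
  moreover have "poly L 0 = (\<Sum>z\<in>R. poly (Q z) 0 / poly (pderiv f) z)"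
    unfolding L_def poly_sum by simp
  ultimately have "1 = (\<Sum>z\<in>R. poly (Q z) 0 / poly (pderiv f) z)" by simp
  also have "\<dots> = (\<Sum>z\<in>R. - poly f 0 * (1 / (z * poly (pderiv f) z)))"
  proof (rule sum.cong)
    fix z assume z: "z \<in> R"
    then have "z \<noteq> 0" using assms(4) by (auto simp: R_def)
    moreover have "poly f 0 = - z * poly (Q z) 0"
      by (subst fQ[OF z]) simp
    ultimately show "poly (Q z) 0 / poly (pderiv f) z = - poly f 0 * (1 / (z * poly (pderiv f) z))"
      by simp
  qed simp
  also have "\<dots> = - poly f 0 * (\<Sum>z\<in>R. 1 / (z * poly (pderiv f) z))"
    by (simp only: sum_distrib_left)
  finally have "poly f 0 * (\<Sum>z\<in>R. 1 / (z * poly (pderiv f) z)) = - 1"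
    by (metis add.inverse_inverse mult_minus_left)
  then show ?thesis using assms(4)
    unfolding R_def[symmetric] using nonzero_eq_divide_eq[OF assms(4)] by (metis mult.commute)
qed

text \<open>
  Partial fractions, then the Cauchy--Schwarz inequality in the form
  \<open>(\<Sum>i. t i)^2 \<le> k (\<Sum>i. (t i)^2)\<close> for \<open>k\<close> zeros.  If \<open>f\<close> has a multiple zero or vanishes at
  the origin, one summand on the right is infinite.
\<close>

lemma mean_inverse_square_roots_ge:
  fixes f :: "complex poly"
  assumes "lead_coeff f = 1" "0 < degree f"
  shows "inverse (ennreal ((degree f * cmod (poly f 0))\<^sup>2))
    \<le> (\<Sum>z | poly f z = 0. (inverse (ennreal (cmod z * cmod (poly (pderiv f) z))))\<^sup>2) 
        / of_nat (card {z. poly f z = 0})" (is "?l \<le> sum ?t ?R / _")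
proof -
  have f0: "f \<noteq> 0" using assms by auto
  then have fin: "finite ?R" by (simp add: poly_roots_finite)
  show ?thesis
  proof (cases "rsquarefree f \<and> poly f 0 \<noteq> 0")
    case False
    then obtain z where z: "z \<in> ?R" "cmod z * cmod (poly (pderiv f) z) = 0"
      by (auto simp: rsquarefree_roots)
    then have "?t z = \<infinity>"
      by (simp only: ennreal_0 ennreal_inverse_zero power_top_ennreal infinity_ennreal_def zero_less_numeral)
    then have "sum ?t ?R = \<infinity>"
      using z fin by (auto simp: ennreal_sum_eq_top)
    then show ?thesis by (simp add: ennreal_top_divide)
  next
    case True
    define u where "u z = 1 / (z * poly (pderiv f) z)" for z
    define k where "k = card ?R"
    have nz: "z \<noteq> 0" "poly (pderiv f) z \<noteq> 0" if "z \<in> ?R" for z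
      using that True by (auto simp: rsquarefree_roots)
    have "?R \<noteq> {}" 
      using fundamental_theorem_of_algebra[of f] assms(2) by (auto simp: constant_degree)
    then have k: "0 < k" unfolding k_def using fin by (simp add: card_gt_0_iff)
    have kd: "k \<le> degree f" unfolding k_def using f0 by (rule card_poly_roots_bound)
    have "1 / cmod (poly f 0) = cmod (\<Sum>z\<in>?R. u z)"
      unfolding u_def using partial_fraction_at_0 assms True by (simp add: norm_divide)
    also have "\<dots> \<le> (\<Sum>z\<in>?R. cmod (u z))" by (rule norm_sum)
    finally have "(1 / cmod (poly f 0))\<^sup>2 \<le> (\<Sum>z\<in>?R. cmod (u z))\<^sup>2"
      by (intro power_mono) auto
    also have "\<dots> \<le> (\<Sum>z\<in>?R. (cmod (u z))\<^sup>2) * k"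
      unfolding k_def by (rule sum_squared_le_sum_of_squares)
    finally have "(1 / cmod (poly f 0))\<^sup>2 / k / k \<le> (\<Sum>z\<in>?R. (cmod (u z))\<^sup>2) * k / k / k"
      by (intro divide_right_mono) auto
    then have "1 / (k * cmod (poly f 0))\<^sup>2 \<le> (\<Sum>z\<in>?R. (cmod (u z))\<^sup>2) / k"
      using k by (simp add: power2_eq_square mult_ac)
    moreover have "1 / (degree f * cmod (poly f 0))\<^sup>2 \<le> 1 / (k * cmod (poly f 0))\<^sup>2"
      using k kd True by (intro divide_left_mono power_mono mult_right_mono) auto
    ultimately have le: "1 / (degree f * cmod (poly f 0))\<^sup>2 \<le> (\<Sum>z\<in>?R. (cmod (u z))\<^sup>2) / k"
      by linarith
    have t: "?t z = ennreal ((cmod (u z))\<^sup>2)" if "z \<in> ?R" for z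
      using nz[OF that] by (simp add: u_def inverse_ennreal ennreal_power norm_divide norm_mult inverse_eq_divide)
    have "sum ?t ?R = ennreal (\<Sum>z\<in>?R. (cmod (u z))\<^sup>2)"
      by (subst sum_ennreal[symmetric]) (auto intro!: sum.cong simp: t)
    then have "sum ?t ?R / of_nat k = ennreal ((\<Sum>z\<in>?R. (cmod (u z))\<^sup>2) / k)"
      using k by (simp add: ennreal_of_nat_eq_real_of_nat divide_ennreal sum_nonneg)
    moreover have "?l = ennreal (1 / (degree f * cmod (poly f 0))\<^sup>2)"
      using True assms(2) by (subst inverse_ennreal) (auto simp: inverse_eq_divide)
    ultimately show ?thesis
      using le unfolding k_def by (simp add: ennreal_leI)
  qed
qed

section \<open>Uniformly distributed eigenvalues as a measurable kernel\<close>

definition separated_subsets :: "'a::metric_space set \<Rightarrow> nat \<Rightarrow> real \<Rightarrow> 'a set set" where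
  "separated_subsets Q k e =
     {F. finite F \<and> F \<subseteq> Q \<and> card F = k \<and> (\<forall>p\<in>F. \<forall>q\<in>F. p \<noteq> q \<longrightarrow> 2 * e < dist p q)}"

lemma finite_set_separation:
  fixes S :: "'a::metric_space set"
  assumes "finite S"
  obtains d where "0 < d" "\<And>x y. x \<in> S \<Longrightarrow> y \<in> S \<Longrightarrow> x \<noteq> y \<Longrightarrow> d \<le> dist x y"
proof -
  \<comment> \<open>The element 1 keeps \<open>D\<close> nonempty when \<open>S\<close> has at most one point.\<close>
  define D where "D = insert 1 ((\<lambda>(x, y). dist x y) ` {(x, y). x \<in> S \<and> y \<in> S \<and> x \<noteq> y})"
  have "finite {(x, y). x \<in> S \<and> y \<in> S \<and> x \<noteq> y}"
    by (rule finite_subset[of _ "S \<times> S"]) (use assms in auto)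
  then have fD: "finite D" by (simp add: D_def)
  have "0 < Min D" using fD by (subst Min_gr_iff) (auto simp: D_def)
  moreover have "Min D \<le> dist x y" if "x \<in> S" "y \<in> S" "x \<noteq> y" for x y
    by (rule Min_le[OF fD]) (use that in \<open>auto simp: D_def\<close>)
  ultimately show ?thesis by (rule that)
qed

text \<open>
  The right-hand side says that \<open>S\<close> meets each of \<open>k\<close> closed balls of radius \<open>1 / (m + 1)\<close>
  with centres in the dense set \<open>Q\<close>; the separation of the centres makes the balls disjoint.  If \<open>Q\<close>
  is countable, this expresses the cardinality through countably many conditions on single balls.
\<close>

lemma le_card_iff_separated:
  fixes S :: "'a::metric_space set"
  assumes fin: "finite S" and Q: "\<And>X. open X \<Longrightarrow> X \<noteq> {} \<Longrightarrow> \<exists>q\<in>Q. q \<in> (X :: 'a set)"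
  shows "k \<le> card S \<longleftrightarrow>
    (\<exists>m. \<exists>F\<in>separated_subsets Q k (inverse (real (Suc m))).
       \<forall>q\<in>F. \<exists>s\<in>S. dist q s \<le> inverse (real (Suc m)))" (is "_ \<longleftrightarrow> ?R")
proof
  assume "k \<le> card S"
  then obtain S' where S': "S' \<subseteq> S" "card S' = k" "finite S'"
    using obtain_subset_with_card_n by metis
  obtain d where d: "0 < d" "\<And>x y. x \<in> S' \<Longrightarrow> y \<in> S' \<Longrightarrow> x \<noteq> y \<Longrightarrow> d \<le> dist x y"
    using finite_set_separation[OF S'(3)] by blast
  \<comment> \<open>Moving two points by less than \<open>d / 4\<close> leaves more than half of their distance.\<close>
  obtain m :: nat where m: "inverse (real (Suc m)) < d / 4"
    using reals_Archimedean[of "d / 4"] d(1) by auto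
  define e where "e = inverse (real (Suc m))"
  have e: "0 < e" "e < d / 4" using m by (auto simp: e_def)
  have "\<exists>q\<in>Q. q \<in> ball x e" for x using e by (intro Q) auto
  then have "\<forall>x. \<exists>q. q \<in> Q \<and> dist x q < e" by auto
  from choice[OF this] obtain q where q: "\<And>x. q x \<in> Q" "\<And>x. dist x (q x) < e" by blast
  have sep: "2 * e < dist (q x) (q y)" if "x \<in> S'" "y \<in> S'" "x \<noteq> y" for x y
  proof -
    have "d \<le> dist x y" using d(2) that by simp
    also have "\<dots> \<le> dist x (q x) + dist (q x) (q y) + dist y (q y)"
      using dist_triangle[of x y "q x"] dist_triangle[of "q x" y "q y"] by (simp add: dist_commute)
    finally show ?thesis using q(2)[of x] q(2)[of y] e by linarith
  qed
  have "inj_on q S'"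
  proof (rule inj_onI, rule ccontr)
    fix x y assume "x \<in> S'" "y \<in> S'" "q x = q y" "x \<noteq> y"
    then show False using sep[of x y] e(1) by simp
  qed
  then have "q ` S' \<in> separated_subsets Q k e"
    unfolding separated_subsets_def using S' q(1) sep by (auto simp: card_image)
  moreover have "\<forall>p\<in>q ` S'. \<exists>s\<in>S. dist p s \<le> e"
  proof
    fix p assume "p \<in> q ` S'"
    then obtain x where "x \<in> S'" "p = q x" by blast
    then show "\<exists>s\<in>S. dist p s \<le> e"
      using S'(1) q(2)[of x] by (intro bexI[of _ x]) (auto simp: dist_commute)
  qed
  ultimately show ?R unfolding e_def by blast
next
  assume ?R
  then obtain m F where "F \<in> separated_subsets Q k (inverse (real (Suc m)))"
    and hit: "\<forall>q\<in>F. \<exists>s\<in>S. dist q s \<le> inverse (real (Suc m))" by blast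
  then have F: "finite F" "card F = k"
    and sep: "\<And>p q. p \<in> F \<Longrightarrow> q \<in> F \<Longrightarrow> p \<noteq> q \<Longrightarrow> 2 * inverse (real (Suc m)) < dist p q"
    unfolding separated_subsets_def by auto
  obtain s where s: "\<And>q. q \<in> F \<Longrightarrow> s q \<in> S" "\<And>q. q \<in> F \<Longrightarrow> dist q (s q) \<le> inverse (real (Suc m))"
    using bchoice[OF hit[unfolded Bex_def]] by blast
  have "inj_on s F"
  proof (rule inj_onI, rule ccontr)
    fix p q assume pq: "p \<in> F" "q \<in> F" "s p = s q" "p \<noteq> q"
    have "dist p q \<le> dist p (s p) + dist q (s q)"
      using dist_triangle2[of p q "s p"] pq(3) by simp
    then show False using sep[OF pq(1,2,4)] s(2)[OF pq(1)] s(2)[OF pq(2)] by linarith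
  qed
  then show "k \<le> card S"
    using card_inj_on_le[of s F S] s(1) fin F(2) by (simp add: image_subset_iff)
qed

text \<open>
  For a fixed ball, the points \<open>x\<close> whose section meets that ball form the projection of a closed
  set along a compact factor, hence a closed set.  The preceding test expresses
  \<open>k \<le> card\<close> through countably many such sets.
\<close>

lemma borel_measurable_card_sections:
  fixes T :: "('a::euclidean_space \<times> 'b::euclidean_space) set"
  assumes T: "closed T" and fin: "\<And>x. finite {y. (x, y) \<in> T}"
  shows "(\<lambda>x. real (card {y. (x, y) \<in> T})) \<in> borel_measurable borel"
  unfolding borel_measurable_iff_ge
proof
  fix a :: real
  obtain Q :: "'b set" where Q: "countable Q" "\<And>X. open X \<Longrightarrow> X \<noteq> {} \<Longrightarrow> \<exists>q\<in>Q. q \<in> X"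
    by (erule countable_dense_setE)
  define H where "H q r = {x. \<exists>y\<in>{y. (x, y) \<in> T}. dist q y \<le> r}" for q :: 'b and r :: real
  have "closed ((\<lambda>(y, x). (x, y)) -` T)"
    using T by (intro closed_vimage) (auto intro!: continuous_intros simp: case_prod_unfold)
  then have "closed {x. \<exists>y. y \<in> cball q r \<and> (y, x) \<in> (\<lambda>(y, x). (x, y)) -` T}" for q r
    by (intro closed_compact_projection compact_cball)
  moreover have "H q r = {x. \<exists>y. y \<in> cball q r \<and> (y, x) \<in> (\<lambda>(y, x). (x, y)) -` T}" for q r
    by (auto simp: H_def)
  ultimately have H: "H q r \<in> sets borel" for q r by simp
  define k where "k = nat \<lceil>a\<rceil>"
  have iff: "k \<le> card {y. (x, y) \<in> T} \<longleftrightarrow>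
      (\<exists>m. \<exists>F\<in>separated_subsets Q k (inverse (real (Suc m))).
         \<forall>q\<in>F. x \<in> H q (inverse (real (Suc m))))" for x
    unfolding H_def mem_Collect_eq by (rule le_card_iff_separated[OF fin]) (rule Q(2))
  have "{x \<in> space borel. a \<le> real (card {y. (x, y) \<in> T})} = {x. k \<le> card {y. (x, y) \<in> T}}"
    unfolding k_def by (simp add: nat_le_iff ceiling_le_iff)
  also have "\<dots> = (\<Union>m. \<Union>F\<in>separated_subsets Q k (inverse (real (Suc m))).
                     \<Inter>q\<in>F. H q (inverse (real (Suc m))))"
    by (simp add: set_eq_iff iff)
  also have "\<dots> \<in> sets borel"
  proof (intro sets.countable_UN' sets.countable_UN image_subsetI)
    fix m :: nat
    show "countable (separated_subsets Q k (inverse (real (Suc m))))"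
      by (rule countable_subset[OF _ countable_Collect_finite_subset[OF Q(1)]])
         (auto simp: separated_subsets_def)
    fix F assume "F \<in> separated_subsets Q k (inverse (real (Suc m)))"
    then have "finite F" by (simp add: separated_subsets_def)
    then show "(\<Inter>q\<in>F. H q (inverse (real (Suc m)))) \<in> sets borel"
      by (cases "F = {}") (auto intro!: sets.finite_INT H)
  qed (rule countableI_type)
  finally show "{x \<in> space borel. a \<le> real (card {y. (x, y) \<in> T})} \<in> sets borel" .
qed

lemma continuous_on_det [continuous_intros]:
  fixes f :: "'x::topological_space \<Rightarrow> ('a::{comm_ring_1, real_normed_algebra_1})^'n^'n"
  assumes "continuous_on S f"
  shows "continuous_on S (\<lambda>x. det (f x))"
  unfolding det_def
  by (intro continuous_intros continuous_on_component assms)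

lemma borel_measurable_det: "det \<in> borel_measurable (borel :: (complex^'n^'n) measure)"
  by (intro borel_measurable_continuous_onI continuous_intros)

lemma continuous_on_mat [continuous_intros]:
  fixes f :: "'x::topological_space \<Rightarrow> 'a::{zero, topological_space}"
  assumes "continuous_on S f"
  shows "continuous_on S (\<lambda>x. mat (f x) :: 'a^'n^'n)"
  unfolding mat_def
proof (intro continuous_on_vec_lambda)
  fix i j :: 'n
  show "continuous_on S (\<lambda>x. if i = j then f x else 0)"
    by (cases "i = j") (use assms in auto)
qed

lemma closed_eigenpairs: "closed (eigenpairs :: ((complex^'n^'n) \<times> complex) set)"
proof -
  have "closed {p :: (complex^'n^'n) \<times> complex. det (fst p - mat (snd p)) = 0}"
    by (intro closed_Collect_eq continuous_intros)
  then show ?thesis by (simp add: eigenpairs_def case_prod_unfold)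
qed

text \<open>
  The derivative is a limit of difference quotients, so the measurability of the evaluations
  suffices and the coefficients need not be considered.
\<close>

lemma borel_measurable_poly_pderiv:
  fixes p :: "'x \<Rightarrow> complex poly" and z :: "'x \<Rightarrow> complex"
  assumes "\<And>c. (\<lambda>x. poly (p x) (z x + c)) \<in> borel_measurable M"
  shows "(\<lambda>x. poly (pderiv (p x)) (z x)) \<in> borel_measurable M"
proof (rule borel_measurable_LIMSEQ_metric)
  fix i :: nat
  show "(\<lambda>x. (poly (p x) (z x + inverse (complex_of_nat (Suc i))) - poly (p x) (z x + 0)) / inverse (complex_of_nat (Suc i)))
      \<in> borel_measurable M"
    by (intro borel_measurable_divide borel_measurable_diff assms borel_measurable_const)
next
  fix x
  have "((\<lambda>c. (poly (p x) (z x + c) - poly (p x) (z x)) / c) \<longlongrightarrow> poly (pderiv (p x)) (z x)) (at 0)"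
    using poly_DERIV[of "p x" "z x"] by (simp add: DERIV_def)
  moreover have "filterlim (\<lambda>i. inverse (complex_of_nat (Suc i))) (at 0) sequentially"
    unfolding filterlim_at using LIMSEQ_inverse_real_of_nat LIMSEQ_Suc[OF lim_inverse_n]
    by (auto simp: of_nat_neq_0 simp del: of_nat_Suc)
  ultimately show "(\<lambda>i. (poly (p x) (z x + inverse (complex_of_nat (Suc i))) - poly (p x) (z x + 0)) / inverse (complex_of_nat (Suc i)))
      \<longlonglongrightarrow> poly (pderiv (p x)) (z x)"
    using filterlim_compose by (auto simp del: of_nat_Suc)
qed

text \<open>
  Closed sets generate the Borel sets and are stable under intersection, so the kernel need only be
  tested on them; there it is a quotient of two cardinalities of sections.
\<close>

lemma measurable_uniform_eigenvalue_kernel: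
  assumes fin: "\<And>A :: complex^'n^'n. finite {l. (A, l) \<in> eigenpairs}"
    and ne: "\<And>A :: complex^'n^'n. {l. (A, l) \<in> eigenpairs} \<noteq> {}"
  shows "(\<lambda>A :: complex^'n^'n. distr (measure_pmf (pmf_of_set {l. (A, l) \<in> eigenpairs})) borel (\<lambda>l. (A, l)))
    \<in> borel \<rightarrow>\<^sub>M subprob_algebra borel"
proof (rule measurable_prob_algebraD, rule measurable_prob_algebra_generated)
  show "sets (borel :: ((complex^'n^'n) \<times> complex) measure) = sigma_sets UNIV (Collect closed)"
    by (simp add: borel_eq_closed)
  show "Int_stable (Collect closed :: ((complex^'n^'n) \<times> complex) set set)"
    by (auto simp: Int_stable_def)
  fix A :: "complex^'n^'n"
  show "prob_space (distr (measure_pmf (pmf_of_set {l. (A, l) \<in> eigenpairs})) borel (\<lambda>l. (A, l)))"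
    by (rule measure_pmf.prob_space_distr) simp
next
  fix B :: "((complex^'n^'n) \<times> complex) set" assume "B \<in> Collect closed"
  then have B: "closed B" by simp
  have "emeasure (distr (measure_pmf (pmf_of_set {l. (A, l) \<in> eigenpairs})) borel (\<lambda>l. (A, l))) B
     = ennreal (real (card {l. (A, l) \<in> eigenpairs \<inter> B}) / real (card {l. (A, l) \<in> eigenpairs}))" for A
    using B fin[of A] ne[of A]
    by (subst emeasure_distr) (auto simp: emeasure_pmf_of_set Int_def)
  moreover have "(\<lambda>A :: complex^'n^'n. real (card {l. (A, l) \<in> eigenpairs \<inter> B})) \<in> borel_measurable borel"
    using B closed_eigenpairs
    by (intro borel_measurable_card_sections closed_Int finite_subset[OF _ fin]) auto
  moreover have "(\<lambda>A :: complex^'n^'n. real (card {l. (A, l) \<in> eigenpairs})) \<in> borel_measurable borel"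
    using closed_eigenpairs fin by (rule borel_measurable_card_sections)
  ultimately show "(\<lambda>A. emeasure (distr (measure_pmf (pmf_of_set {l. (A, l) \<in> eigenpairs})) borel (\<lambda>l. (A, l))) B)
     \<in> borel_measurable borel" by simp
qed auto

section \<open>The inverse square of a Gaussian determinant\<close>

abbreviation std_normal :: "real measure" where
  "std_normal \<equiv> density lborel std_normal_density"

lemma emeasure_std_normal_interval_ge:
  assumes "a \<le> b" "\<bar>a\<bar> \<le> R" "\<bar>b\<bar> \<le> R"
  shows "ennreal (std_normal_density R * (b - a)) \<le> emeasure std_normal {a<..b}"
proof -
  have *: "std_normal_density R \<le> std_normal_density x" if "x \<in> {a<..b}" for x
  proof -
    have "\<bar>x\<bar> \<le> \<bar>R\<bar>" using that assms by auto
    then have "x\<^sup>2 \<le> R\<^sup>2" by (simp only: abs_le_square_iff)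
    then show ?thesis by (simp add: std_normal_density_def divide_right_mono)
  qed
  have "ennreal (std_normal_density R * (b - a)) = ennreal (std_normal_density R) * emeasure lborel {a<..b}"
    using assms(1) by (simp add: ennreal_mult)
  also have "\<dots> = (\<integral>\<^sup>+x. ennreal (std_normal_density R) * indicator {a<..b} x \<partial>lborel)"
    by (simp add: nn_integral_cmult)
  also have "\<dots> \<le> (\<integral>\<^sup>+x. ennreal (std_normal_density x) * indicator {a<..b} x \<partial>lborel)"
    using * by (intro nn_integral_mono) (auto simp: indicator_def intro!: ennreal_leI)
  also have "\<dots> = emeasure std_normal {a<..b}"
    by (simp add: emeasure_density)
  finally show ?thesis .
qed

lemma emeasure_std_normal_open_pos:
  assumes "open X" "c \<in> X"
  shows "0 < emeasure std_normal X"
proof -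
  obtain e where e: "0 < e" "\<And>y. dist y c < e \<Longrightarrow> y \<in> X"
    using assms unfolding open_dist by blast
  have "0 < std_normal_density (\<bar>c\<bar> + e) * (c + e / 2 - c)"
    using e by (intro mult_pos_pos normal_density_pos) auto
  then have "0 < ennreal (std_normal_density (\<bar>c\<bar> + e) * (c + e / 2 - c))"
    by (simp only: ennreal_less_zero_iff)
  also have "\<dots> \<le> emeasure std_normal {c<..c + e / 2}"
    by (rule emeasure_std_normal_interval_ge) (use e(1) in auto)
  also have "\<dots> \<le> emeasure std_normal X"
    by (rule emeasure_mono) (use e assms in \<open>auto simp: dist_real_def\<close>)
  finally show ?thesis .
qed

text \<open>
  Near \<open>(p, q)\<close> the density is bounded below, and the dyadic squares
  \<open>(p + h/2, p + h] \<times> (q + h/2, q + h]\<close> with \<open>h = 2^-k\<close> are disjoint.  On such a square the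
  integrand is at least \<open>1 / (2 h^2)\<close>, while its area is \<open>h^2 / 4\<close>; so every square contributes at
  least the same positive amount.
\<close>

lemma std_normal_inverse_square_dist:
  "(\<integral>\<^sup>+v. \<integral>\<^sup>+u. inverse (ennreal ((u - p)\<^sup>2 + (v - q)\<^sup>2)) \<partial>std_normal \<partial>std_normal) = \<infinity>"
proof -
  define h where "h k = (1 / 2 :: real) ^ k" for k :: nat
  have h: "0 < h k" "h k \<le> 1" "h (Suc k) = h k / 2" for k
    by (auto simp: h_def power_le_one)
  define A where "A c k = {c + h (Suc k)<..c + h k}" for c k
  have A_disj: "j = k" if "x \<in> A c j" "x \<in> A c k" for x c j k
  proof -
    have "\<not> j < k" if "x \<in> A c j" "x \<in> A c k" for j k
    proof
      assume "j < k"
      then have "h k \<le> h (Suc j)" unfolding h_def by (intro power_decreasing) auto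
      then show False using that by (auto simp: A_def)
    qed
    then show ?thesis using that by (meson linorder_neqE_nat)
  qed
  define F where "F k u v = indicator (A q k) v * (ennreal (1 / (2 * (h k)\<^sup>2)) * indicator (A p k) u)"
    for k :: nat and u v :: real
  \<comment> \<open>All squares lie in \<open>[-R, R]\<close> in both coordinates.\<close>
  define R where "R = \<bar>p\<bar> + \<bar>q\<bar> + 1"
  define c where "c = std_normal_density R"
  have c: "0 < c" unfolding c_def by (rule normal_density_pos) simp
  have mA: "ennreal (c * (h k / 2)) \<le> emeasure std_normal (A r k)" if "r = p \<or> r = q" for r k
  proof -
    have "ennreal (std_normal_density R * ((r + h k) - (r + h (Suc k)))) \<le> emeasure std_normal (A r k)"
      unfolding A_def
      by (rule emeasure_std_normal_interval_ge) (use that h[of k] in \<open>auto simp: R_def\<close>)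
    then show ?thesis by (simp add: h(3) c_def)
  qed
  have F_le: "(\<Sum>k. F k u v) \<le> inverse (ennreal ((u - p)\<^sup>2 + (v - q)\<^sup>2))" for u v
  proof (cases "\<exists>k. u \<in> A p k \<and> v \<in> A q k")
    case True
    then obtain k where k: "u \<in> A p k" "v \<in> A q k" by blast
    have "F j u v = 0" if "j \<noteq> k" for j
      using A_disj[of u p j k] k that by (auto simp: F_def indicator_def)
    then have "(\<Sum>k. F k u v) = (\<Sum>j\<in>{k}. F j u v)"
      by (intro suminf_finite) auto
    also have "\<dots> = ennreal (1 / (2 * (h k)\<^sup>2))"
      using k by (simp add: F_def)
    also have "\<dots> \<le> ennreal (1 / ((u - p)\<^sup>2 + (v - q)\<^sup>2))"
    proof (intro ennreal_leI divide_left_mono)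
      have u: "0 < u - p" "u - p \<le> h k" and v: "0 < v - q" "v - q \<le> h k"
        using k h[of k] by (auto simp: A_def)
      then have "(u - p)\<^sup>2 \<le> (h k)\<^sup>2" "(v - q)\<^sup>2 \<le> (h k)\<^sup>2"
        by (auto intro!: power_mono)
      then show "(u - p)\<^sup>2 + (v - q)\<^sup>2 \<le> 2 * (h k)\<^sup>2" by simp
      have "0 < (u - p)\<^sup>2 + (v - q)\<^sup>2" using u v by (intro add_pos_pos zero_less_power) auto
      then show "0 < 2 * (h k)\<^sup>2 * ((u - p)\<^sup>2 + (v - q)\<^sup>2)"
        using h(1)[of k] by simp
    qed auto
    also have "\<dots> = inverse (ennreal ((u - p)\<^sup>2 + (v - q)\<^sup>2))"
    proof -
      have "0 < (u - p)\<^sup>2 + (v - q)\<^sup>2"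
        using k h[of k] by (intro add_pos_pos) (auto simp: A_def)
      then show ?thesis by (simp add: inverse_ennreal inverse_eq_divide del: ennreal_plus)
    qed
    finally show ?thesis .
  next
    case False
    then have "F k u v = 0" for k by (auto simp: F_def indicator_def)
    then show ?thesis by simp
  qed
  have mset[measurable]: "A r k \<in> sets borel" for r k by (simp add: A_def)
  have "\<infinity> = (\<Sum>k::nat. ennreal (c\<^sup>2 / 8))"
  proof (rule ccontr)
    assume "\<infinity> \<noteq> (\<Sum>k::nat. ennreal (c\<^sup>2 / 8))"
    then have "summable (\<lambda>k::nat. c\<^sup>2 / 8)"
      by (intro summable_suminf_not_top) auto
    then show False using c by (simp add: summable_const_iff)
  qed
  also have "\<dots> \<le> (\<Sum>k. emeasure std_normal (A q k) *
      (ennreal (1 / (2 * (h k)\<^sup>2)) * emeasure std_normal (A p k)))"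
  proof (intro suminf_le)
    fix k
    have "ennreal (c\<^sup>2 / 8) = ennreal (c * (h k / 2)) * (ennreal (1 / (2 * (h k)\<^sup>2)) * ennreal (c * (h k / 2)))"
      using h(1)[of k] c by (simp add: ennreal_mult[symmetric] power2_eq_square)
    also have "\<dots> \<le> emeasure std_normal (A q k) * (ennreal (1 / (2 * (h k)\<^sup>2)) * emeasure std_normal (A p k))"
      by (intro mult_mono mA) auto
    finally show "ennreal (c\<^sup>2 / 8) \<le> \<dots>" .
  qed auto
  also have "\<dots> = (\<Sum>k. \<integral>\<^sup>+v. \<integral>\<^sup>+u. F k u v \<partial>std_normal \<partial>std_normal)"
    unfolding F_def by (simp add: nn_integral_cmult nn_integral_multc)
  also have "\<dots> = (\<integral>\<^sup>+v. (\<Sum>k. \<integral>\<^sup>+u. F k u v \<partial>std_normal) \<partial>std_normal)"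
    by (rule nn_integral_suminf[symmetric]) (simp add: F_def nn_integral_cmult)
  also have "\<dots> = (\<integral>\<^sup>+v. \<integral>\<^sup>+u. (\<Sum>k. F k u v) \<partial>std_normal \<partial>std_normal)"
    by (intro nn_integral_cong nn_integral_suminf[symmetric]) (simp add: F_def)
  also have "\<dots> \<le> (\<integral>\<^sup>+v. \<integral>\<^sup>+u. inverse (ennreal ((u - p)\<^sup>2 + (v - q)\<^sup>2)) \<partial>std_normal \<partial>std_normal)"
    by (intro nn_integral_mono F_le)
  finally show ?thesis by (simp add: top.extremum_unique)
qed

lemma std_normal_inverse_square_affine:
  fixes M r :: complex
  assumes "M \<noteq> 0"
  shows "(\<integral>\<^sup>+v. \<integral>\<^sup>+u. inverse (ennreal ((cmod (Complex u v * M + r))\<^sup>2)) \<partial>std_normal \<partial>std_normal) = \<infinity>"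
proof -
  interpret prob_space std_normal by (rule prob_space_normal_density) simp
  define z where "z = - r / M"
  define c where "c = inverse (ennreal ((cmod M)\<^sup>2))"
  have "inverse (ennreal ((cmod (Complex u v * M + r))\<^sup>2)) =
      c * inverse (ennreal ((u - Re z)\<^sup>2 + (v - Im z)\<^sup>2))" for u v
  proof -
    have "Complex u v * M + r = M * (Complex u v - z)"
      using assms by (simp add: z_def field_simps)
    then have "(cmod (Complex u v * M + r))\<^sup>2 = (cmod M)\<^sup>2 * (cmod (Complex u v - z))\<^sup>2"
      by (simp add: norm_mult power_mult_distrib)
    also have "(cmod (Complex u v - z))\<^sup>2 = (u - Re z)\<^sup>2 + (v - Im z)\<^sup>2"
      by (simp add: cmod_power2)
    finally show ?thesis
      unfolding c_def using assms
      by (simp add: ennreal_mult ennreal_inverse_mult' ennreal_less_top)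
  qed
  moreover have "c \<noteq> 0" unfolding c_def by simp
  ultimately show ?thesis
    by (simp add: nn_integral_cmult std_normal_inverse_square_dist ennreal_mult_top del: ennreal_plus)
qed

definition matrix_of_coords :: "('n \<times> 'n \<times> bool \<Rightarrow> real) \<Rightarrow> complex^'n^'n" where
  "matrix_of_coords x = (\<chi> i j. Complex (x (i, j, False)) (x (i, j, True)))"

text \<open>
  Its determinant is the cofactor of the entry \<open>(k, k)\<close>; replacing a row by a unit vector keeps the
  index type, whereas deleting a row and a column would change it.
\<close>

definition cofactor_matrix :: "'n \<Rightarrow> complex^'n^'n \<Rightarrow> complex^'n^'n" where
  "cofactor_matrix k A = (\<chi> i. if i = k then axis k 1 else A $ i)"

lemma continuous_matrix_of_coords:
  "continuous_on UNIV (matrix_of_coords :: ('n::finite \<times> 'n \<times> bool \<Rightarrow> real) \<Rightarrow> complex^'n^'n)"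
  unfolding matrix_of_coords_def Complex_eq
  by (intro continuous_intros continuous_on_product_coordinates)

lemma measurable_matrix_of_coords [measurable]:
  "matrix_of_coords \<in> (\<Pi>\<^sub>M k\<in>(UNIV :: ('n::finite \<times> 'n \<times> bool) set). std_normal) \<rightarrow>\<^sub>M borel"
proof -
  have "sets (\<Pi>\<^sub>M k\<in>(UNIV :: ('n \<times> 'n \<times> bool) set). std_normal) = sets borel"
    using sets_PiM_equal_borel by (simp cong: sets_PiM_cong)
  then show ?thesis
    using borel_measurable_continuous_onI[OF continuous_matrix_of_coords]
    by (simp cong: measurable_cong_sets)
qed

lemma det_change_entry:
  fixes x :: "'n::finite \<times> 'n \<times> bool \<Rightarrow> real"
  obtains r where "\<And>u v. det (matrix_of_coords (x((k, k, True) := v, (k, k, False) := u))) =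
     Complex u v * det (cofactor_matrix k (matrix_of_coords x)) + r"
proof
  fix u v
  let ?A = "matrix_of_coords x"
  let ?R = "\<chi> j. if j = k then 0 else ?A $ k $ j"
  have "matrix_of_coords (x((k, k, True) := v, (k, k, False) := u)) =
      (\<chi> i. if i = k then Complex u v *s axis k 1 + ?R else ?A $ i)"
    by (auto simp: matrix_of_coords_def vec_eq_iff axis_def)
  then show "det (matrix_of_coords (x((k, k, True) := v, (k, k, False) := u))) =
     Complex u v * det (cofactor_matrix k ?A) + det (\<chi> i. if i = k then ?R else ?A $ i)"
    unfolding cofactor_matrix_def
    by (simp only: det_row_add[of k "\<lambda>_. Complex u v *s axis k 1" "\<lambda>_. ?R"]
        det_row_mul[of k "Complex u v" "\<lambda>_. axis k 1"])
qed

text \<open>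
  By Fubini, the two real coordinates of the entry \<open>(k, k)\<close> are integrated first.  The resulting
  inner integral is infinite wherever the cofactor of that entry is nonzero, which holds on a box of
  positive measure around the coordinates of the identity matrix.
\<close>

lemma expectation_inverse_square_det_infinite:
  "(\<integral>\<^sup>+A. inverse (ennreal ((cmod (det A))\<^sup>2)) \<partial>(std_gaussian_matrix :: (complex^'n^'n) measure)) = \<infinity>"
proof -
  interpret prob_space std_normal by (rule prob_space_normal_density) simp
  interpret product_sigma_finite "\<lambda>_ :: 'n \<times> 'n \<times> bool. std_normal"
    by standard
  obtain k :: 'n where True by blast
  define J where "J = UNIV - {(k, k, True), (k, k, False)}"
  have UNIV_eq: "insert (k, k, False) (insert (k, k, True) J) = UNIV"
    by (auto simp: J_def)
  note borel_measurable_det [measurable]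
  have [measurable]: "(\<lambda>A :: complex^'n^'n. inverse (ennreal ((cmod (det A))\<^sup>2))) \<in> borel_measurable borel"
    by measurable
  define f where "f x = inverse (ennreal ((cmod (det (matrix_of_coords x)))\<^sup>2))" for x :: "'n \<times> 'n \<times> bool \<Rightarrow> real"
  have f: "f \<in> borel_measurable (\<Pi>\<^sub>M k\<in>UNIV. std_normal)"
    unfolding f_def by measurable
  \<comment> \<open>The coordinates of the identity matrix.\<close>
  define c :: "'n \<times> 'n \<times> bool \<Rightarrow> real" where "c = (\<lambda>(i, j, b). if i = j \<and> \<not> b then 1 else 0)"
  define cof where "cof x = det (cofactor_matrix k (matrix_of_coords x))" for x :: "'n \<times> 'n \<times> bool \<Rightarrow> real"
  have "cofactor_matrix k (matrix_of_coords c) = mat 1"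
    by (auto simp: cofactor_matrix_def matrix_of_coords_def c_def mat_def vec_eq_iff axis_def complex_eq_iff)
  then have cof_c: "cof c \<noteq> 0" unfolding cof_def by simp
  have "continuous_on UNIV (\<lambda>x. cofactor_matrix k (matrix_of_coords x))"
    unfolding cofactor_matrix_def
  proof (intro continuous_on_vec_lambda)
    fix i
    show "continuous_on UNIV (\<lambda>x. if i = k then axis k 1 else matrix_of_coords x $ i)"
      using continuous_matrix_of_coords by (cases "i = k") (auto intro: continuous_on_component)
  qed
  then have "continuous_on UNIV cof"
    unfolding cof_def by (rule continuous_on_det)
  then have "open {x. cof x \<noteq> 0}"
    by (intro open_Collect_neq continuous_on_const)
  then have "openin (product_topology (\<lambda>i. euclidean) UNIV) {x. cof x \<noteq> 0}"
    by (simp add: open_fun_def)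
  from product_topology_open_contains_basis[OF this, of c] cof_c
  obtain X where X: "c \<in> Pi\<^sub>E UNIV X" "\<And>i. open (X i)" "Pi\<^sub>E UNIV X \<subseteq> {x. cof x \<noteq> 0}"
    by auto
  have cof_nz: "cof x \<noteq> 0" if "x \<in> Pi\<^sub>E J X" for x
  proof -
    \<comment> \<open>The cofactor ignores the coordinates outside \<open>J\<close>, where \<open>x\<close> is undefined.\<close>
    define y where "y = (\<lambda>i. if i \<in> J then x i else c i)"
    have "y \<in> Pi\<^sub>E UNIV X" using that X(1) by (simp add: y_def PiE_iff)
    moreover have "cofactor_matrix k (matrix_of_coords y) = cofactor_matrix k (matrix_of_coords x)"
      by (auto simp: cofactor_matrix_def matrix_of_coords_def y_def J_def vec_eq_iff)
    then have "cof y = cof x" by (simp add: cof_def)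
    ultimately show ?thesis using X(3) by auto
  qed
  let ?P = "\<Pi>\<^sub>M k\<in>J. std_normal"
  have mX: "Pi\<^sub>E J X \<in> sets ?P"
    using X(2) by (intro sets_PiM_I_finite) auto
  have X_pos: "emeasure std_normal (X i) \<noteq> 0" for i
    using emeasure_std_normal_open_pos[OF X(2), of "c i" i] X(1) by (cases i) (simp add: PiE_iff)
  have "emeasure ?P (Pi\<^sub>E J X) = (\<Prod>i\<in>J. emeasure std_normal (X i))"
    using X(2) by (intro emeasure_PiM) auto
  also have "\<dots> \<noteq> 0"
    using X_pos by (simp add: J_def)
  finally have pos: "emeasure ?P (Pi\<^sub>E J X) \<noteq> 0" .
  have "\<infinity> = \<infinity> * emeasure ?P (Pi\<^sub>E J X)"
    using pos by (simp add: ennreal_top_mult)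
  also have "\<dots> = (\<integral>\<^sup>+x. \<infinity> * indicator (Pi\<^sub>E J X) x \<partial>?P)"
    using mX by (rule nn_integral_cmult_indicator[symmetric])
  also have "\<dots> \<le> (\<integral>\<^sup>+x. \<integral>\<^sup>+v. \<integral>\<^sup>+u. f (x((k, k, True) := v, (k, k, False) := u)) \<partial>std_normal \<partial>std_normal \<partial>?P)"
  proof (intro nn_integral_mono)
    fix x
    obtain r where r: "\<And>u v. det (matrix_of_coords (x((k, k, True) := v, (k, k, False) := u))) =
       Complex u v * cof x + r"
      unfolding cof_def using det_change_entry by metis
    show "\<infinity> * indicator (Pi\<^sub>E J X) x \<le>
        (\<integral>\<^sup>+v. \<integral>\<^sup>+u. f (x((k, k, True) := v, (k, k, False) := u)) \<partial>std_normal \<partial>std_normal)"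
      using std_normal_inverse_square_affine[OF cof_nz]
      by (cases "x \<in> Pi\<^sub>E J X") (simp_all add: f_def r)
  qed
  also have "\<dots> = (\<integral>\<^sup>+x. \<integral>\<^sup>+u. f (x((k, k, False) := u)) \<partial>std_normal \<partial>(\<Pi>\<^sub>M k\<in>insert (k, k, True) J. std_normal))"
  proof (rule product_nn_integral_insert[symmetric])
    have "(\<lambda>(x, u). f (x((k, k, False) := u))) \<in>
        borel_measurable ((\<Pi>\<^sub>M k\<in>insert (k, k, True) J. std_normal) \<Otimes>\<^sub>M std_normal)"
      using measurable_compose[OF measurable_add_dim f[folded UNIV_eq]]
      by (simp add: case_prod_unfold)
    then show "(\<lambda>x. \<integral>\<^sup>+u. f (x((k, k, False) := u)) \<partial>std_normal) \<in>
        borel_measurable (\<Pi>\<^sub>M k\<in>insert (k, k, True) J. std_normal)"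
      by (rule borel_measurable_nn_integral)
  qed (auto simp: J_def)
  also have "\<dots> = (\<integral>\<^sup>+x. f x \<partial>(\<Pi>\<^sub>M k\<in>UNIV. std_normal))"
    using f unfolding UNIV_eq[symmetric]
    by (intro product_nn_integral_insert[symmetric]) (auto simp: J_def)
  also have "\<dots> = (\<integral>\<^sup>+A. inverse (ennreal ((cmod (det A))\<^sup>2)) \<partial>(std_gaussian_matrix :: (complex^'n^'n) measure))"
    unfolding std_gaussian_matrix_def f_def matrix_of_coords_def[symmetric]
    by (subst nn_integral_distr) auto
  finally show ?thesis by (simp add: top.extremum_unique)
qed

section \<open>The expectation\<close>

lemma borel_measurable_pderiv_charpoly:
  "(\<lambda>x :: (complex^'n^'n) \<times> complex. poly (pderiv (charpoly (fst x))) (snd x)) \<in> borel_measurable borel"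
  by (rule borel_measurable_poly_pderiv)
     (auto simp: poly_charpoly intro!: borel_measurable_continuous_onI continuous_intros)

lemma mean_over_eigenvalues_ge:
  fixes A :: "complex^'n^'n"
  shows "inverse (ennreal ((real CARD('n))\<^sup>2)) * inverse (ennreal ((cmod (det A))\<^sup>2))
    \<le> (\<Sum>l | (A, l) \<in> eigenpairs. (inverse (ennreal (cmod l * cmod (poly (pderiv (charpoly A)) l))))\<^sup>2)
        / of_nat (card {l. (A, l) \<in> eigenpairs})"
proof -
  have "cmod (poly (charpoly A) 0) = cmod (det A)"
    by (simp add: poly_charpoly det_uminus norm_mult norm_power)
  then show ?thesis
    using mean_inverse_square_roots_ge[of "charpoly A"] degree_monic_charpoly[of A]
    by (simp add: eigenvalues_eq_roots power_mult_distrib ennreal_mult ennreal_inverse_mult' ennreal_less_top)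
qed

text \<open>
  The squared condition number is replaced by the minorant \<open>g\<close> before the integral over
  \<open>rho_std\<close> is disintegrated: \<open>g\<close> is visibly measurable, and the integral is monotone even
  for integrands not known to be so.
\<close>

theorem theorem2:
  "(\<integral>\<^sup>+ (A, l). (cond (charpoly A) l)\<^sup>2 \<partial>(rho_std :: ((complex^'n^'n) \<times> complex) measure))
     \<ge> ennreal (fact (CARD('n) - 1) * 2 ^ CARD('n))"
proof -
  let ?G = "std_gaussian_matrix :: (complex^'n^'n) measure"
  define K where "K = (\<lambda>A :: complex^'n^'n.
      distr (measure_pmf (pmf_of_set {l. (A, l) \<in> eigenpairs})) borel (\<lambda>l. (A, l)))"
  define g where "g = (\<lambda>(A :: complex^'n^'n, l).
      (inverse (ennreal (cmod l * cmod (poly (pderiv (charpoly A)) l))))\<^sup>2)"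
  have rho: "rho_std = restrict_space (?G \<bind> K) eigenpairs"
    unfolding rho_std_def K_def ..
  have fin: "finite {l. (A, l) \<in> eigenpairs}" and ne: "{l. (A, l) \<in> eigenpairs} \<noteq> {}"
    for A :: "complex^'n^'n"
  proof -
    have "charpoly A \<noteq> 0" using degree_monic_charpoly(2)[of A] by auto
    then show "finite {l. (A, l) \<in> eigenpairs}"
      unfolding eigenvalues_eq_roots by (rule poly_roots_finite)
    show "{l. (A, l) \<in> eigenpairs} \<noteq> {}"
      unfolding eigenvalues_eq_roots
      using fundamental_theorem_of_algebra[of "charpoly A"]
      by (auto simp: constant_degree degree_monic_charpoly(1))
  qed
  have sets_G: "sets ?G = sets borel" by (simp add: std_gaussian_matrix_def)
  then have space_G: "space ?G = UNIV" using sets_eq_imp_space_eq[OF sets_G] by simp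
  have K: "K \<in> ?G \<rightarrow>\<^sub>M subprob_algebra borel"
    using measurable_uniform_eigenvalue_kernel[OF fin ne] sets_G
    unfolding K_def by (simp cong: measurable_cong_sets)
  have sets_B: "sets (?G \<bind> K) = sets borel"
    by (rule sets_bind) (use sets_kernel[OF K] space_G in auto)
  then have space_B: "space (?G \<bind> K) = UNIV"
    using sets_eq_imp_space_eq[OF sets_B] by simp
  have E: "eigenpairs \<in> sets (borel :: ((complex^'n^'n) \<times> complex) measure)"
    using closed_eigenpairs by (rule borel_closed)
  have g_le: "g (A, l) \<le> (cond (charpoly A) l)\<^sup>2" if "(A, l) \<in> eigenpairs" for A :: "complex^'n^'n" and l
  proof -
    have "poly (charpoly A) l = 0"
      using that eigenvalues_eq_roots[of A] by blast
    then have "ennreal (poly_norm (charpoly A)) *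
        inverse (ennreal (cmod l * cmod (poly (pderiv (charpoly A)) l))) \<le> cond (charpoly A) l"
      by (rule cond_ge) (simp add: degree_monic_charpoly(1))
    moreover have "1 \<le> ennreal (poly_norm (charpoly A))"
      using poly_norm_monic[OF degree_monic_charpoly(2)] by (simp add: ennreal_ge_1)
    then have "1 * inverse (ennreal (cmod l * cmod (poly (pderiv (charpoly A)) l))) \<le>
        ennreal (poly_norm (charpoly A)) * inverse (ennreal (cmod l * cmod (poly (pderiv (charpoly A)) l)))"
      by (intro mult_right_mono) auto
    ultimately show ?thesis
      unfolding g_def by (simp add: power_mono)
  qed
  note borel_measurable_pderiv_charpoly [measurable]
  have [measurable]: "snd \<in> borel_measurable (borel :: ((complex^'n^'n) \<times> complex) measure)"
    by (intro borel_measurable_continuous_onI continuous_intros)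
  have [measurable]: "g \<in> borel_measurable borel"
    unfolding g_def case_prod_unfold by measurable
  have "\<infinity> = inverse (ennreal ((real CARD('n))\<^sup>2)) * (\<integral>\<^sup>+A. inverse (ennreal ((cmod (det A))\<^sup>2)) \<partial>?G)"
    by (simp add: expectation_inverse_square_det_infinite ennreal_mult_top)
  also have "\<dots> = (\<integral>\<^sup>+A. inverse (ennreal ((real CARD('n))\<^sup>2)) * inverse (ennreal ((cmod (det A))\<^sup>2)) \<partial>?G)"
  proof (rule nn_integral_cmult[symmetric])
    have [measurable]: "det \<in> borel_measurable ?G"
      using borel_measurable_det sets_G by (simp cong: measurable_cong_sets)
    show "(\<lambda>A. inverse (ennreal ((cmod (det A))\<^sup>2))) \<in> borel_measurable ?G" by measurable
  qed
  also have "\<dots> \<le> (\<integral>\<^sup>+A. \<integral>\<^sup>+x. g x * indicator eigenpairs x \<partial>K A \<partial>?G)"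
  proof (rule nn_integral_mono)
    fix A :: "complex^'n^'n"
    have "(\<integral>\<^sup>+x. g x * indicator eigenpairs x \<partial>K A) =
        (\<integral>\<^sup>+l. g (A, l) * indicator eigenpairs (A, l) \<partial>measure_pmf (pmf_of_set {l. (A, l) \<in> eigenpairs}))"
      unfolding K_def using E by (subst nn_integral_distr) auto
    also have "\<dots> = (\<Sum>l | (A, l) \<in> eigenpairs. g (A, l)) / of_nat (card {l. (A, l) \<in> eigenpairs})"
      using fin[of A] ne[of A] by (subst nn_integral_pmf_of_set) (auto simp: ennreal_of_nat_eq_real_of_nat intro!: arg_cong2[of _ _ _ _ "(/)"] sum.cong)
    finally show "inverse (ennreal ((real CARD('n))\<^sup>2)) * inverse (ennreal ((cmod (det A))\<^sup>2))
        \<le> (\<integral>\<^sup>+x. g x * indicator eigenpairs x \<partial>K A)"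
      using mean_over_eigenvalues_ge[of A] by (simp add: g_def)
  qed
  also have "\<dots> = (\<integral>\<^sup>+x. g x * indicator eigenpairs x \<partial>(?G \<bind> K))"
    using K E by (intro nn_integral_bind[symmetric]) auto
  also have "\<dots> = (\<integral>\<^sup>+x. g x \<partial>rho_std)"
    unfolding rho using E sets_B space_B by (subst nn_integral_restrict_space) auto
  also have "\<dots> \<le> (\<integral>\<^sup>+(A, l). (cond (charpoly A) l)\<^sup>2
      \<partial>(rho_std :: ((complex^'n^'n) \<times> complex) measure))"
    using g_le by (intro nn_integral_mono) (auto simp: rho space_restrict_space)
  finally show ?thesis
    by (simp add: top.extremum_unique)
qed

end
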